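(* Let $Y$ and $Z$ be subspaces of a metric space $(X,d)$ and let $a\in Y\cap Z$. Then $Y$ and $Z$ are strongly tangent equivalent at the point $a$ if and only if $$\lim_{t\to 0}\frac{\varepsilon_a(t)}{t}=0,$$ where $t$ ranges over positive reals.
   Context: A normalizing sequence is a sequence $\tilde r=\{r_n\}_{n\in\mathbb N}$ of positive real numbers with $r_n\to 0$. For a set $W$, $\tilde W$ denotes the set of all sequences of points of $W$. Let $(X,d)$ be a metric space, $Y,Z\subseteq X$ subspaces and $a\in Y\cap Z$. The subspaces $Y$ and $Z$ are tangent equivalent at $a$ with respect to a normalizing sequence $\tilde r$ if for every $\tilde y_1=\{y^{(1)}_n\}\in\tilde Y$ and every $\tilde z_1=\{z^{(1)}_n\}\in\tilde Z$ for which the limits $\lim_{n\to\infty} d(y^{(1)}_n,a)/r_n$ and $\lim_{n\to\infty} d(z^{(1)}_n,a)/r_n$ exist and are finite, there exist $\tilde y_2=\{y^{(2)}_n\}\in\tilde Y$ and $\tilde z_2=\{z^{(2)}_n\}\in\tilde Z$ such that $$\lim_{n\to\infty}\frac{d(y^{(1)}_n,z^{(2)}_n)}{r_n}=\lim_{n\to\infty}\frac{d(y^{(2)}_n,z^{(1)}_n)}{r_n}=0.$$ $Y$ and $Z$ are strongly tangent equivalent at $a$ if they are tangent equivalent at $a$ with respect to every normalizing sequence $\tilde r$. For $t>0$ put $S^Y_t=\{y\in Y: d(a,y)=t\}$ and $S^Z_t=\{z\in Z: d(a,z)=t\}$, and $$\varepsilon_a(t,Z,Y)=\sup_{z\in S^Z_t}\inf_{y\in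 Y}d(z,y),\qquad \varepsilon_a(t,Y,Z)=\sup_{y\in S^Y_t}\inf_{z\in Z}d(y,z),$$ where the supremum over the empty set is taken to be $0$. Finally, $\varepsilon_a(t)=\max\{\varepsilon_a(t,Z,Y),\varepsilon_a(t,Y,Z)\}$. *)

theory Defs
  imports "HOL-Analysis.Analysis"
begin

definition normalizing_seq :: "(nat \<Rightarrow> real) \<Rightarrow> bool" where
  "normalizing_seq r \<longleftrightarrow> (\<forall>n. r n > 0) \<and> r \<longlonglongrightarrow> 0"

definition tangent_equivalent ::
    "'a::metric_space \<Rightarrow> (nat \<Rightarrow> real) \<Rightarrow> 'a set \<Rightarrow> 'a set \<Rightarrow> bool" where
  "tangent_equivalent a r Y Z \<longleftrightarrow>
    (\<forall>y1 z1. range y1 \<subseteq> Y \<longrightarrow> range z1 \<subseteq> Z \<longrightarrow>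
       convergent (\<lambda>n. dist (y1 n) a / r n) \<longrightarrow>
       convergent (\<lambda>n. dist (z1 n) a / r n) \<longrightarrow>
       (\<exists>y2 z2. range y2 \<subseteq> Y \<and> range z2 \<subseteq> Z \<and>
          (\<lambda>n. dist (y1 n) (z2 n) / r n) \<longlonglongrightarrow> 0 \<and>
          (\<lambda>n. dist (y2 n) (z1 n) / r n) \<longlonglongrightarrow> 0))"

definition strongly_tangent_equivalent :: "'a::metric_space \<Rightarrow> 'a set \<Rightarrow> 'a set \<Rightarrow> bool" where
  "strongly_tangent_equivalent a Y Z \<longleftrightarrow>
    (\<forall>r. normalizing_seq r \<longrightarrow> tangent_equivalent a r Y Z)"

definition sphere_in :: "'a::metric_space \<Rightarrow> real \<Rightarrow> 'a set \<Rightarrow> 'a set" where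
  "sphere_in a t W = {w \<in> W. dist a w = t}"

text \<open>
  The supremum over the empty set is 0 by convention; on \<^typ>\<open>real\<close>, \<^term>\<open>Sup {}\<close> carries no
  such convention, hence the case distinction. When \<open>a \<in> W\<close>, every infimum below is taken over a
  nonempty set and is at most \<open>t\<close>, so both the infimum and the supremum are genuine real numbers.
\<close>

definition eps_dir :: "'a::metric_space \<Rightarrow> real \<Rightarrow> 'a set \<Rightarrow> 'a set \<Rightarrow> real" where
  "eps_dir a t V W =
    (if sphere_in a t V = {} then 0 else (SUP v \<in> sphere_in a t V. INF w \<in> W. dist v w))"

definition eps :: "'a::metric_space \<Rightarrow> 'a set \<Rightarrow> 'a set \<Rightarrow> real \<Rightarrow> real" where
  "eps a Y Z t = max (eps_dir a t Z Y) (eps_dir a t Y Z)"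

end

theory Submission
  imports Defs
begin

text \<open>
  Both sides of the equivalence split into two independent halves, one for each direction of
  approximation, so it suffices to compare the following for an ordered pair of sets \<open>V\<close>, \<open>W\<close>
  with \<open>a \<in> W\<close>. The first half-condition says that each sequence in \<open>V\<close> whose distance to \<open>a\<close>,
  divided by \<open>r\<close>, converges can be shadowed by a sequence in \<open>W\<close> up to an error \<open>o(r)\<close>; equivalently, the
  distances \<open>infdist (v n) W\<close> are \<open>o(r)\<close>. The second says that the worst value of \<open>infdist v W\<close> over
  the points \<open>v \<in> V\<close> at distance \<open>t\<close> from \<open>a\<close> is \<open>o(t)\<close>.

  If the second holds, put \<open>s n = dist a (v n)\<close>. Then
  \<open>infdist (v n) W / r n \<le> (eps_dir a (s n) V W / s n) * (s n / r n)\<close>, where the first factor tends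
  to \<open>0\<close> and the second is convergent (\<open>shadowed_if_eps_dir_small\<close>). If the second fails, there
  are radii \<open>t n\<close> tending to \<open>0\<close> and points \<open>v n \<in> V\<close> at distance exactly \<open>t n\<close> from \<open>a\<close> that are
  further than a fixed multiple of \<open>t n\<close> from \<open>W\<close>; these points cannot be shadowed when \<open>t\<close> itself
  is the normalizing sequence (\<open>eps_dir_small_if_shadowed\<close>).
\<close>

section \<open>One-sided tangent approximation\<close>

definition shadowed :: "'a::metric_space \<Rightarrow> (nat \<Rightarrow> real) \<Rightarrow> 'a set \<Rightarrow> 'a set \<Rightarrow> bool" where
  "shadowed a r V W \<longleftrightarrow>
    (\<forall>v. range v \<subseteq> V \<longrightarrow> convergent (\<lambda>n. dist (v n) a / r n) \<longrightarrow>
       (\<exists>w. range w \<subseteq> W \<and> (\<lambda>n. dist (v n) (w n) / r n) \<longlonglongrightarrow> 0))"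

text \<open>
  The definition of tangent equivalence quantifies over a pair of sequences at once. The two
  sequences do not interact, and since \<open>a\<close> lies in both sets, the constant sequence \<open>a\<close> can always
  serve as the other member of the pair.
\<close>

lemma tangent_equivalent_iff_shadowed:
  assumes "a \<in> Y" "a \<in> Z"
  shows "tangent_equivalent a r Y Z \<longleftrightarrow> shadowed a r Y Z \<and> shadowed a r Z Y"
proof
  assume te: "tangent_equivalent a r Y Z"
  have const: "range (\<lambda>n::nat. a) \<subseteq> Y" "range (\<lambda>n::nat. a) \<subseteq> Z"
    "convergent (\<lambda>n. dist a a / r n)"
    using assms by (auto simp: convergent_const)
  show "shadowed a r Y Z \<and> shadowed a r Z Y"
    unfolding shadowed_def
  proof (intro conjI allI impI)
    fix v assume "range v \<subseteq> Y" "convergent (\<lambda>n. dist (v n) a / r n)"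
    then show "\<exists>w. range w \<subseteq> Z \<and> (\<lambda>n. dist (v n) (w n) / r n) \<longlonglongrightarrow> 0"
      using te[unfolded tangent_equivalent_def, rule_format, of v "\<lambda>n. a"] const by blast
  next
    fix v assume "range v \<subseteq> Z" "convergent (\<lambda>n. dist (v n) a / r n)"
    then show "\<exists>w. range w \<subseteq> Y \<and> (\<lambda>n. dist (v n) (w n) / r n) \<longlonglongrightarrow> 0"
      using te[unfolded tangent_equivalent_def, rule_format, of "\<lambda>n. a" v] const
      by (auto simp: dist_commute)
  qed
next
  assume sh: "shadowed a r Y Z \<and> shadowed a r Z Y"
  show "tangent_equivalent a r Y Z"
    unfolding tangent_equivalent_def
  proof (intro allI impI)
    fix y1 z1
    assume y1: "range y1 \<subseteq> Y" "convergent (\<lambda>n. dist (y1 n) a / r n)"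
      and z1: "range z1 \<subseteq> Z" "convergent (\<lambda>n. dist (z1 n) a / r n)"
    obtain z2 where "range z2 \<subseteq> Z" "(\<lambda>n. dist (y1 n) (z2 n) / r n) \<longlonglongrightarrow> 0"
      using sh y1 unfolding shadowed_def by blast
    moreover obtain y2 where "range y2 \<subseteq> Y" "(\<lambda>n. dist (z1 n) (y2 n) / r n) \<longlonglongrightarrow> 0"
      using sh z1 unfolding shadowed_def by blast
    ultimately show "\<exists>y2 z2. range y2 \<subseteq> Y \<and> range z2 \<subseteq> Z \<and>
        (\<lambda>n. dist (y1 n) (z2 n) / r n) \<longlonglongrightarrow> 0 \<and> (\<lambda>n. dist (y2 n) (z1 n) / r n) \<longlonglongrightarrow> 0"
      by (subst (2) dist_commute) blast
  qed
qed

text \<open>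
  The infimum defining \<open>infdist\<close> need not be attained, but it suffices to miss it by \<open>o(r)\<close>; the
  proof allows the error \<open>r n / (n + 1)\<close>.
\<close>

lemma shadowing_seq_exists_iff:
  fixes v :: "nat \<Rightarrow> 'a::metric_space"
  assumes pos: "\<And>n. r n > 0" and ne: "W \<noteq> {}"
  shows "(\<exists>w. range w \<subseteq> W \<and> (\<lambda>n. dist (v n) (w n) / r n) \<longlonglongrightarrow> 0) \<longleftrightarrow>
    (\<lambda>n. infdist (v n) W / r n) \<longlonglongrightarrow> 0"
proof
  assume "\<exists>w. range w \<subseteq> W \<and> (\<lambda>n. dist (v n) (w n) / r n) \<longlonglongrightarrow> 0"
  then obtain w where w: "range w \<subseteq> W" and lim: "(\<lambda>n. dist (v n) (w n) / r n) \<longlonglongrightarrow> 0"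
    by blast
  have "infdist (v n) W / r n \<le> dist (v n) (w n) / r n" for n
    using w pos[of n] by (intro divide_right_mono infdist_le) auto
  moreover have "0 \<le> infdist (v n) W / r n" for n
    using pos[of n] by (simp add: infdist_nonneg)
  ultimately show "(\<lambda>n. infdist (v n) W / r n) \<longlonglongrightarrow> 0"
    by (intro tendsto_sandwich[OF _ _ tendsto_const lim]) auto
next
  assume lim: "(\<lambda>n. infdist (v n) W / r n) \<longlonglongrightarrow> 0"
  have "\<exists>w\<in>W. dist (v n) w < infdist (v n) W + r n * inverse (real (Suc n))" for n
  proof -
    have "(INF w\<in>W. dist (v n) w) < infdist (v n) W + r n * inverse (real (Suc n))"
      using pos[of n] ne by (simp add: infdist_notempty)
    then show ?thesis
      using ne by (subst (asm) cINF_less_iff) auto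
  qed
  then obtain w where w: "\<And>n. w n \<in> W"
    and close: "\<And>n. dist (v n) (w n) < infdist (v n) W + r n * inverse (real (Suc n))"
    by metis
  have "dist (v n) (w n) / r n \<le> infdist (v n) W / r n + inverse (real (Suc n))" for n
    using divide_right_mono[OF less_imp_le[OF close[of n]], of "r n"] pos[of n]
    by (simp add: add_divide_distrib)
  moreover have bound: "(\<lambda>n. infdist (v n) W / r n + inverse (real (Suc n))) \<longlonglongrightarrow> 0"
    using tendsto_add[OF lim LIMSEQ_inverse_real_of_nat] by simp
  moreover have "0 \<le> dist (v n) (w n) / r n" for n
    using pos[of n] by simp
  ultimately have "(\<lambda>n. dist (v n) (w n) / r n) \<longlonglongrightarrow> 0"
    by (intro tendsto_sandwich[OF _ _ tendsto_const bound] always_eventually allI)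
  moreover have "range w \<subseteq> W"
    using w by auto
  ultimately show "\<exists>w. range w \<subseteq> W \<and> (\<lambda>n. dist (v n) (w n) / r n) \<longlonglongrightarrow> 0"
    by (intro exI[of _ w] conjI)
qed

section \<open>One-sided deviation on spheres\<close>

text \<open>
  Since \<open>a \<in> W\<close>, each infimum over the sphere of radius \<open>t\<close> is at most \<open>t\<close>. This bound makes the
  conditionally complete supremum in \<open>eps_dir\<close> meaningful.
\<close>

lemma bdd_above_infdist_sphere_in:
  assumes "a \<in> W"
  shows "bdd_above ((\<lambda>v. infdist v W) ` sphere_in a t V)"
  by (rule bdd_aboveI[of _ t])
    (use infdist_le[OF assms] in \<open>auto simp: sphere_in_def dist_commute\<close>)

lemma eps_dir_eq_infdist:
  assumes "W \<noteq> {}"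
  shows "eps_dir a t V W =
    (if sphere_in a t V = {} then 0 else (SUP v \<in> sphere_in a t V. infdist v W))"
  using assms by (simp add: eps_dir_def infdist_notempty)

lemma infdist_le_eps_dir:
  assumes "a \<in> W" "v \<in> V"
  shows "infdist v W \<le> eps_dir a (dist a v) V W"
proof -
  have "v \<in> sphere_in a (dist a v) V"
    using assms by (simp add: sphere_in_def)
  moreover from this have "infdist v W \<le> (SUP v \<in> sphere_in a (dist a v) V. infdist v W)"
    by (rule cSUP_upper[OF _ bdd_above_infdist_sphere_in[OF \<open>a \<in> W\<close>]])
  moreover have "W \<noteq> {}"
    using assms by blast
  ultimately show ?thesis
    by (auto simp: eps_dir_eq_infdist)
qed

lemma eps_dir_nonneg:
  assumes "a \<in> W"
  shows "0 \<le> eps_dir a t V W"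
proof (cases "sphere_in a t V = {}")
  case False
  then obtain v where "v \<in> V" "dist a v = t"
    by (auto simp: sphere_in_def)
  then show ?thesis
    using infdist_le_eps_dir[OF assms] infdist_nonneg[of v W] by (meson order_trans)
qed (simp add: eps_dir_def)

lemma less_eps_dir_obtains_point:
  assumes "a \<in> W" "0 \<le> c" "c < eps_dir a t V W"
  obtains v where "v \<in> V" "dist a v = t" "c < infdist v W"
proof -
  have ne: "sphere_in a t V \<noteq> {}"
    using assms by (auto simp: eps_dir_def)
  moreover have "W \<noteq> {}"
    using assms by blast
  ultimately have "c < (SUP v \<in> sphere_in a t V. infdist v W)"
    using assms by (simp add: eps_dir_eq_infdist)
  then obtain v where "v \<in> sphere_in a t V" "c < infdist v W"
    using less_cSUP_iff[OF ne bdd_above_infdist_sphere_in[OF \<open>a \<in> W\<close>]] by blast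
  then show ?thesis
    by (intro that) (auto simp: sphere_in_def)
qed

section \<open>Approximation and deviation\<close>

lemma shadowed_if_eps_dir_small:
  fixes a :: "'a::metric_space"
  assumes aW: "a \<in> W" and small: "((\<lambda>t. eps_dir a t V W / t) \<longlongrightarrow> 0) (at_right 0)"
    and r: "normalizing_seq r"
  shows "shadowed a r V W"
  unfolding shadowed_def
proof (intro allI impI)
  fix v assume v: "range v \<subseteq> V" and conv: "convergent (\<lambda>n. dist (v n) a / r n)"
  define s where "s n = dist a (v n)" for n
  have pos: "r n > 0" for n
    using r by (simp add: normalizing_seq_def)
  obtain c where c: "(\<lambda>n. s n / r n) \<longlonglongrightarrow> c"
    using conv by (auto simp: convergent_def s_def dist_commute)
  have s: "s \<longlonglongrightarrow> 0"
  proof -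
    have "(\<lambda>n. s n / r n * r n) \<longlonglongrightarrow> c * 0"
      using r by (intro tendsto_mult c) (simp add: normalizing_seq_def)
    moreover have "s n / r n * r n = s n" for n
      using pos[of n] by simp
    ultimately show ?thesis by simp
  qed
  \<comment> \<open>Some \<open>v n\<close> may equal \<open>a\<close>. Division by zero gives the quotient the value \<open>0\<close> at \<open>t = 0\<close>, which
    is its one-sided limit, so it is continuous there from the right and may be composed with \<open>s\<close>
    even where \<open>s\<close> vanishes.\<close>
  have "continuous (at 0 within {0..}) (\<lambda>t. eps_dir a t V W / t)"
    using small by (simp add: continuous_within at_within_Ici_at_right)
  from continuous_within_tendsto_compose'[OF this _ s]
  have "(\<lambda>n. eps_dir a (s n) V W / s n) \<longlonglongrightarrow> 0"
    by (simp add: s_def)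
  from tendsto_mult[OF this c]
  have lim: "(\<lambda>n. eps_dir a (s n) V W / s n * (s n / r n)) \<longlonglongrightarrow> 0"
    by simp
  have "infdist (v n) W / r n \<le> eps_dir a (s n) V W / s n * (s n / r n)" for n
  proof (cases "s n = 0")
    case True
    then show ?thesis
      using aW by (simp add: s_def)
  next
    case False
    have "infdist (v n) W \<le> eps_dir a (s n) V W"
      unfolding s_def using v by (intro infdist_le_eps_dir aW) auto
    then show ?thesis
      using False pos[of n] by (simp add: divide_right_mono)
  qed
  moreover have "0 \<le> infdist (v n) W / r n" for n
    using pos[of n] by (simp add: infdist_nonneg)
  ultimately have "(\<lambda>n. infdist (v n) W / r n) \<longlonglongrightarrow> 0"
    by (intro tendsto_sandwich[OF _ _ tendsto_const lim]) auto
  moreover have "W \<noteq> {}"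
    using aW by blast
  ultimately show "\<exists>w. range w \<subseteq> W \<and> (\<lambda>n. dist (v n) (w n) / r n) \<longlonglongrightarrow> 0"
    using shadowing_seq_exists_iff[of r W v] pos by blast
qed

text \<open>
  The points that witness a failure of smallness lie at distance exactly \<open>t n\<close> from \<open>a\<close>. Hence the
  radii \<open>t\<close>, used as normalizing sequence, give the normalized distances the constant value \<open>1\<close>, and
  the shadowing hypothesis applies. The radii must be picked where \<open>eps_dir\<close> is large: along an
  arbitrary sequence of radii the spheres might be empty.
\<close>

lemma eps_dir_small_if_shadowed:
  fixes a :: "'a::metric_space"
  assumes aW: "a \<in> W" and shad: "\<And>r. normalizing_seq r \<Longrightarrow> shadowed a r V W"
  shows "((\<lambda>t. eps_dir a t V W / t) \<longlongrightarrow> 0) (at_right 0)"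
proof (rule ccontr)
  assume "\<not> ?thesis"
  then obtain e where e: "e > 0"
    and "\<not> (\<forall>\<^sub>F t in at_right 0. dist (eps_dir a t V W / t) 0 < e)"
    by (auto simp: tendsto_iff)
  then have "\<exists>t>0. t < b \<and> e \<le> \<bar>eps_dir a t V W / t\<bar>" if "b > 0" for b
    using that by (force simp: eventually_at_right not_less)
  then have "\<exists>t>0. t < b \<and> e * t \<le> eps_dir a t V W" if "b > 0" for b
    using that eps_dir_nonneg[OF aW] by (fastforce simp: pos_le_divide_eq)
  then have "\<exists>t>0. t < inverse (real (Suc n)) \<and> e * t \<le> eps_dir a t V W" for n
    by simp
  then obtain t where t0: "\<And>n. t n > 0" and t1: "\<And>n. t n < inverse (real (Suc n))"
    and large: "\<And>n. e * t n \<le> eps_dir a (t n) V W"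
    by metis
  have "t \<longlonglongrightarrow> 0"
    by (rule tendsto_sandwich[OF _ _ tendsto_const LIMSEQ_inverse_real_of_nat])
      (intro always_eventually allI less_imp_le t0 t1)+
  then have t: "normalizing_seq t"
    using t0 by (simp add: normalizing_seq_def)
  have "\<exists>v\<in>V. dist a v = t n \<and> e / 2 * t n < infdist v W" for n
  proof -
    \<comment> \<open>The supremum need not be attained; halving \<open>e\<close> leaves room for a point near it.\<close>
    have "0 \<le> e / 2 * t n" "e / 2 * t n < eps_dir a (t n) V W"
      using large[of n] mult_pos_pos[OF e t0[of n]] by simp_all
    then show ?thesis
      using less_eps_dir_obtains_point[OF aW] by metis
  qed
  then obtain v where v: "\<And>n. v n \<in> V" "\<And>n. dist a (v n) = t n"
    and far: "\<And>n. e / 2 * t n < infdist (v n) W"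
    by metis
  have "dist (v n) a / t n = 1" for n
    using v(2)[of n] t0[of n] by (simp add: dist_commute)
  then have "convergent (\<lambda>n. dist (v n) a / t n)"
    by (simp only: convergent_const)
  then have "\<exists>w. range w \<subseteq> W \<and> (\<lambda>n. dist (v n) (w n) / t n) \<longlonglongrightarrow> 0"
    using shad[OF t] v(1) by (auto simp: shadowed_def)
  moreover have "W \<noteq> {}"
    using aW by blast
  ultimately have lim: "(\<lambda>n. infdist (v n) W / t n) \<longlonglongrightarrow> 0"
    using shadowing_seq_exists_iff[of t W v] t0 by blast
  have "e / 2 \<le> infdist (v n) W / t n" for n
    using far[of n] t0[of n] by (simp add: pos_le_divide_eq)
  then have "e / 2 \<le> 0"
    by (intro LIMSEQ_le_const[OF lim]) auto
  then show False
    using e by simp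
qed

lemma eps_small_iff:
  assumes "a \<in> Y" "a \<in> Z"
  shows "((\<lambda>t. eps a Y Z t / t) \<longlongrightarrow> 0) (at_right 0) \<longleftrightarrow>
    ((\<lambda>t. eps_dir a t Y Z / t) \<longlongrightarrow> 0) (at_right 0) \<and>
    ((\<lambda>t. eps_dir a t Z Y / t) \<longlongrightarrow> 0) (at_right 0)"
proof (intro iffI conjI)
  assume lim: "((\<lambda>t. eps a Y Z t / t) \<longlongrightarrow> 0) (at_right 0)"
  have pos: "\<forall>\<^sub>F t in at_right (0::real). t > 0"
    by (rule eventually_at_right_less)
  show "((\<lambda>t. eps_dir a t Y Z / t) \<longlongrightarrow> 0) (at_right 0)"
    by (rule tendsto_sandwich[OF _ _ tendsto_const lim]; rule eventually_mono[OF pos])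
      (auto simp: eps_def eps_dir_nonneg assms intro!: divide_right_mono)
  show "((\<lambda>t. eps_dir a t Z Y / t) \<longlongrightarrow> 0) (at_right 0)"
    by (rule tendsto_sandwich[OF _ _ tendsto_const lim]; rule eventually_mono[OF pos])
      (auto simp: eps_def eps_dir_nonneg assms intro!: divide_right_mono)
next
  assume "((\<lambda>t. eps_dir a t Y Z / t) \<longlongrightarrow> 0) (at_right 0) \<and>
    ((\<lambda>t. eps_dir a t Z Y / t) \<longlongrightarrow> 0) (at_right 0)"
  then have "((\<lambda>t. max (eps_dir a t Z Y / t) (eps_dir a t Y Z / t)) \<longlongrightarrow> max 0 0) (at_right 0)"
    by (intro tendsto_max) auto
  moreover have "\<forall>\<^sub>F t in at_right 0.
      max (eps_dir a t Z Y / t) (eps_dir a t Y Z / t) = eps a Y Z t / t"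
    using eventually_at_right_less[of "0::real"]
    by eventually_elim (auto simp: eps_def max_def divide_le_cancel)
  ultimately show "((\<lambda>t. eps a Y Z t / t) \<longlongrightarrow> 0) (at_right 0)"
    using Lim_transform_eventually by fastforce
qed

theorem theorem3p1:
  fixes Y Z :: "'a::metric_space set" and a :: 'a
  assumes "a \<in> Y \<inter> Z"
  shows "strongly_tangent_equivalent a Y Z \<longleftrightarrow>
    ((\<lambda>t. eps a Y Z t / t) \<longlongrightarrow> 0) (at_right 0)"
proof -
  have a: "a \<in> Y" "a \<in> Z"
    using assms by auto
  have "strongly_tangent_equivalent a Y Z \<longleftrightarrow>
      (\<forall>r. normalizing_seq r \<longrightarrow> shadowed a r Y Z) \<and>
      (\<forall>r. normalizing_seq r \<longrightarrow> shadowed a r Z Y)"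
    unfolding strongly_tangent_equivalent_def tangent_equivalent_iff_shadowed[OF a] by blast
  also have "\<dots> \<longleftrightarrow> ((\<lambda>t. eps_dir a t Y Z / t) \<longlongrightarrow> 0) (at_right 0) \<and>
      ((\<lambda>t. eps_dir a t Z Y / t) \<longlongrightarrow> 0) (at_right 0)"
    using shadowed_if_eps_dir_small eps_dir_small_if_shadowed a by blast
  also have "\<dots> \<longleftrightarrow> ((\<lambda>t. eps a Y Z t / t) \<longlongrightarrow> 0) (at_right 0)"
    using eps_small_iff[OF a] by simp
  finally show ?thesis .
qed

end
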